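(* Let $G$ be a graph. Then $G$ is cop-win if and only if $G$ has finite corner rank. Furthermore, if $G$ is an $r$-cop-win graph ($r\in\{0,1\}$) of finite corner rank $\alpha\ge 2$, then $\operatorname{capt}(G)=\alpha-r$.
   Context: All graphs are finite, have at least one vertex, and are reflexive: every vertex is regarded as adjacent to itself. For a vertex $v$, $N[v]$ is its closed neighborhood (all vertices adjacent to $v$, including $v$). For distinct vertices $v,w$ of a graph $H$: $w$ corners $v$ in $H$ if every vertex of $H$ adjacent to $v$ is adjacent to $w$; $w$ strictly corners $v$ in $H$ if moreover some vertex of $H$ adjacent to $w$ is not adjacent to $v$; $v,w$ are twins in $H$ if their closed neighborhoods in $H$ coincide. A strict corner of $H$ is a vertex strictly cornered in $H$ by some other vertex. $G-X$ denotes the subgraph induced by $V(G)\setminus X$. Corner ranking: define $\mathrm{cr}:V(G)\to\{1,2,\dots\}\cup\{\infty\}$ and graphs $G_1,G_2,\dots$ as follows. Set $G_1=G$, $k=1$. If $G_k$ is a clique, set $\mathrm{cr}(x)=k$ for all $x\in V(G_k)$ and stop. Else, if $G_k$ has no strict corners, set $\mathrm{cr}(x)=\infty$ for all $x\in V(G_k)$ and stop. Else let $X$ be the set of strict corners of $G_k$, set $\mathrm{cr}(x)=k$ for $x\in X$, let $G_{k+1}=G_k-X$, increase $k$ by one and repeat. The corner rank $\mathrm{cr}(G)$ is the largest value of $\mathrm{cr}$ on $V(G)$ ($\infty$ exceeding all integers); $G$ has finite corner rank if $\mathrm{cr}(G)$ is an integer. For $G$ of finite corner rank $\alpha\ge 2$: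 $G$ is $1$-cop-win if some (equivalently, every) vertex of rank $\alpha$ is adjacent to every vertex of $G_{\alpha-1}$; otherwise $G$ is $0$-cop-win. Game of cops and robber (one cop, one robber): the cop chooses a starting vertex, then the robber does; then they alternate moves, the cop moving first; a move consists of staying put or moving to an adjacent vertex; the cop wins if both occupy the same vertex. $G$ is cop-win if the cop can force a win. For cop-win $G$, the capture time $\operatorname{capt}(G)$ is the minimum number of cop moves (the initial placement not counted) within which the cop can guarantee a win. *)

theory Defs
  imports Main "HOL-Library.Extended_Nat"
begin

text \<open>A graph is given by its vertex set and its adjacency relation; only the values of \<open>adj\<close> on
  the vertex set matter. Hence the subgraph induced by \<open>U\<close> is given by \<open>U\<close> and the same \<open>adj\<close>.\<close>

locale reflexive_graph =
  fixes V :: "'a set" and adj :: "'a \<Rightarrow> 'a \<Rightarrow> bool"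
  assumes finite_verts: "finite V"
    and nonempty_verts: "V \<noteq> {}"
    and adj_refl: "v \<in> V \<Longrightarrow> adj v v"
    and adj_sym: "v \<in> V \<Longrightarrow> w \<in> V \<Longrightarrow> adj v w \<Longrightarrow> adj w v"

definition is_clique :: "'a set \<Rightarrow> ('a \<Rightarrow> 'a \<Rightarrow> bool) \<Rightarrow> bool" where
  "is_clique V adj \<longleftrightarrow> (\<forall>v\<in>V. \<forall>w\<in>V. adj v w)"


section \<open>Corner ranking\<close>

definition corners :: "'a set \<Rightarrow> ('a \<Rightarrow> 'a \<Rightarrow> bool) \<Rightarrow> 'a \<Rightarrow> 'a \<Rightarrow> bool" where
  "corners V adj w v \<longleftrightarrow> w \<in> V \<and> v \<in> V \<and> w \<noteq> v \<and> (\<forall>x\<in>V. adj x v \<longrightarrow> adj x w)"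

definition strictly_corners :: "'a set \<Rightarrow> ('a \<Rightarrow> 'a \<Rightarrow> bool) \<Rightarrow> 'a \<Rightarrow> 'a \<Rightarrow> bool" where
  "strictly_corners V adj w v \<longleftrightarrow> corners V adj w v \<and> (\<exists>x\<in>V. adj x w \<and> \<not> adj x v)"

definition strict_corners :: "'a set \<Rightarrow> ('a \<Rightarrow> 'a \<Rightarrow> bool) \<Rightarrow> 'a set" where
  "strict_corners V adj = {v \<in> V. \<exists>w\<in>V. strictly_corners V adj w v}"

text \<open>The vertex set of \<open>G\<^sub>k\<close>, for \<open>k \<ge> 1\<close>. The ranking procedure only ever looks at those
  \<open>k\<close> for which it has not stopped yet; beyond that the sequence is constant.\<close>

definition stage :: "'a set \<Rightarrow> ('a \<Rightarrow> 'a \<Rightarrow> bool) \<Rightarrow> nat \<Rightarrow> 'a set" where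
  "stage V adj k = ((\<lambda>U. U - strict_corners U adj) ^^ (k - 1)) V"

text \<open>The rank assigned to a vertex \<open>x\<close> of \<open>G\<^sub>k\<close> by the procedure resumed at step \<open>k\<close>.
  On a finite graph the recursion terminates, since a recursive call goes to a smaller stage.\<close>

partial_function (tailrec) rank_from ::
    "'a set \<Rightarrow> ('a \<Rightarrow> 'a \<Rightarrow> bool) \<Rightarrow> nat \<Rightarrow> 'a \<Rightarrow> enat" where
  "rank_from V adj k x =
     (if is_clique (stage V adj k) adj then enat k
      else if strict_corners (stage V adj k) adj = {} then \<infinity>
      else if x \<in> strict_corners (stage V adj k) adj then enat k
      else rank_from V adj (Suc k) x)"

definition vertex_rank :: "'a set \<Rightarrow> ('a \<Rightarrow> 'a \<Rightarrow> bool) \<Rightarrow> 'a \<Rightarrow> enat" where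
  "vertex_rank V adj = rank_from V adj 1"

definition corner_rank :: "'a set \<Rightarrow> ('a \<Rightarrow> 'a \<Rightarrow> bool) \<Rightarrow> enat" where
  "corner_rank V adj = Max (vertex_rank V adj ` V)"

definition finite_corner_rank :: "'a set \<Rightarrow> ('a \<Rightarrow> 'a \<Rightarrow> bool) \<Rightarrow> bool" where
  "finite_corner_rank V adj \<longleftrightarrow> corner_rank V adj \<noteq> \<infinity>"

definition one_cop_win :: "'a set \<Rightarrow> ('a \<Rightarrow> 'a \<Rightarrow> bool) \<Rightarrow> bool" where
  "one_cop_win V adj \<longleftrightarrow>
     (\<exists>\<alpha>\<ge>2. corner_rank V adj = enat \<alpha> \<and>
        (\<exists>x\<in>V. vertex_rank V adj x = enat \<alpha> \<and> (\<forall>y \<in> stage V adj (\<alpha> - 1). adj x y)))"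

definition zero_cop_win :: "'a set \<Rightarrow> ('a \<Rightarrow> 'a \<Rightarrow> bool) \<Rightarrow> bool" where
  "zero_cop_win V adj \<longleftrightarrow>
     (\<exists>\<alpha>\<ge>2. corner_rank V adj = enat \<alpha>) \<and> \<not> one_cop_win V adj"

definition r_cop_win :: "nat \<Rightarrow> 'a set \<Rightarrow> ('a \<Rightarrow> 'a \<Rightarrow> bool) \<Rightarrow> bool" where
  "r_cop_win r V adj \<longleftrightarrow> r = 0 \<and> zero_cop_win V adj \<or> r = 1 \<and> one_cop_win V adj"


section \<open>The game of cops and robber\<close>

text \<open>\<open>\<rho> 0\<close> is the robber's starting vertex and \<open>\<rho> n\<close> his position after his \<open>n\<close>-th move.
  A finite play can always be continued, by staying put.\<close>

definition robber_play :: "'a set \<Rightarrow> ('a \<Rightarrow> 'a \<Rightarrow> bool) \<Rightarrow> (nat \<Rightarrow> 'a) \<Rightarrow> bool" where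
  "robber_play V adj \<rho> \<longleftrightarrow> (\<forall>n. \<rho> n \<in> V \<and> adj (\<rho> n) (\<rho> (Suc n)))"

text \<open>A cop strategy \<open>\<sigma>\<close> maps the list of robber positions so far to the cop's next position.
  In particular \<open>\<sigma> []\<close> is the cop's starting vertex, chosen before the robber's, and the
  \<open>n\<close>-th cop move may depend on \<open>\<rho> 0, \<dots>, \<rho> (n - 1)\<close> only.\<close>

definition cop_pos :: "('a list \<Rightarrow> 'a) \<Rightarrow> (nat \<Rightarrow> 'a) \<Rightarrow> nat \<Rightarrow> 'a" where
  "cop_pos \<sigma> \<rho> n = \<sigma> (map \<rho> [0..<n])"

definition cop_strategy :: "'a set \<Rightarrow> ('a \<Rightarrow> 'a \<Rightarrow> bool) \<Rightarrow> ('a list \<Rightarrow> 'a) \<Rightarrow> bool" where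
  "cop_strategy V adj \<sigma> \<longleftrightarrow>
     (\<forall>\<rho>. robber_play V adj \<rho> \<longrightarrow>
        (\<forall>n. cop_pos \<sigma> \<rho> n \<in> V \<and> adj (cop_pos \<sigma> \<rho> n) (cop_pos \<sigma> \<rho> (Suc n))))"

text \<open>Both are on the same vertex at some point before the \<open>(n + 1)\<close>-st cop move. The first
  disjunct is the situation after the robber's placement or \<open>m\<close>-th move, the second one the
  situation right after the cop's \<open>(m + 1)\<close>-st move.\<close>

definition captured_within :: "('a list \<Rightarrow> 'a) \<Rightarrow> (nat \<Rightarrow> 'a) \<Rightarrow> nat \<Rightarrow> bool" where
  "captured_within \<sigma> \<rho> n \<longleftrightarrow>
     (\<exists>m\<le>n. cop_pos \<sigma> \<rho> m = \<rho> m) \<or> (\<exists>m<n. cop_pos \<sigma> \<rho> (Suc m) = \<rho> m)"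

definition cop_win :: "'a set \<Rightarrow> ('a \<Rightarrow> 'a \<Rightarrow> bool) \<Rightarrow> bool" where
  "cop_win V adj \<longleftrightarrow>
     (\<exists>\<sigma>. cop_strategy V adj \<sigma> \<and> (\<forall>\<rho>. robber_play V adj \<rho> \<longrightarrow> (\<exists>n. captured_within \<sigma> \<rho> n)))"

definition cop_wins_within :: "'a set \<Rightarrow> ('a \<Rightarrow> 'a \<Rightarrow> bool) \<Rightarrow> nat \<Rightarrow> bool" where
  "cop_wins_within V adj n \<longleftrightarrow>
     (\<exists>\<sigma>. cop_strategy V adj \<sigma> \<and> (\<forall>\<rho>. robber_play V adj \<rho> \<longrightarrow> captured_within \<sigma> \<rho> n))"

text \<open>Meaningful for cop-win graphs only.\<close>

definition capture_time :: "'a set \<Rightarrow> ('a \<Rightarrow> 'a \<Rightarrow> bool) \<Rightarrow> nat" where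
  "capture_time V adj = (LEAST n. cop_wins_within V adj n)"

end

theory Submission
  imports Defs
begin

text \<open>Folding every strict corner of \<open>G\<^sub>k\<close> onto a vertex of \<open>G\<^sub>k\<^sub>+\<^sub>1\<close> that strictly corners it
  is a retraction and a graph homomorphism; composing these maps projects \<open>G\<close> onto each \<open>G\<^sub>k\<close>.
  The cop wins by first moving onto the projection of the robber to the last stage and then onto
  his projections to larger and larger stages: if \<open>r\<close> and \<open>r'\<close> are adjacent, then the projection
  of \<open>r\<close> to \<open>G\<^sub>k\<^sub>+\<^sub>1\<close> is adjacent to the projection of \<open>r'\<close> to \<open>G\<^sub>k\<close>. Conversely, the
  robber survives \<open>k\<close> cop moves from any vertex of \<open>G\<^sub>k\<close> not adjacent to the cop's projection to
  \<open>G\<^sub>k\<close>, by retreating to such a vertex of \<open>G\<^sub>k\<^sub>-\<^sub>1\<close>, and such a starting vertex exists unless some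
  vertex dominates \<open>G\<^sub>k\<close>.\<close>

section \<open>Folding strict corners\<close>

text \<open>The image must itself avoid the strict corners, so that one application lands in the
  next stage; \<open>strict_corner_dominated\<close> shows that such a choice exists.\<close>

definition retract :: "'a set \<Rightarrow> ('a \<Rightarrow> 'a \<Rightarrow> bool) \<Rightarrow> 'a \<Rightarrow> 'a" where
  "retract V adj x =
     (if x \<in> strict_corners V adj
      then SOME w. w \<in> V - strict_corners V adj \<and> strictly_corners V adj w x else x)"

lemma strict_corners_clique: "is_clique V adj \<Longrightarrow> strict_corners V adj = {}"
  by (auto simp: is_clique_def strict_corners_def strictly_corners_def)

lemma strictly_corners_trans:
  assumes "strictly_corners V adj u w" "strictly_corners V adj w x"
  shows "strictly_corners V adj u x"
  using assms unfolding strictly_corners_def corners_def by blast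

context reflexive_graph
begin

text \<open>Take a vertex of maximal degree among those strictly cornering \<open>x\<close>:
  anything strictly cornering it would also strictly corner \<open>x\<close> and have larger
  degree.\<close>

lemma strict_corner_dominated:
  assumes "x \<in> strict_corners V adj"
  obtains w where "w \<in> V - strict_corners V adj" "strictly_corners V adj w x"
proof -
  let ?P = "\<lambda>w. strictly_corners V adj w x"
  let ?deg = "\<lambda>w. card {y \<in> V. adj y w}"
  obtain w0 where "?P w0"
    using assms by (auto simp: strict_corners_def)
  moreover have "\<forall>w. ?P w \<longrightarrow> ?deg w < Suc (card V)"
    using finite_verts by (auto intro: le_imp_less_Suc card_mono)
  ultimately have "\<exists>w. ?P w \<and> (\<forall>u. ?P u \<longrightarrow> ?deg u \<le> ?deg w)"
    by (rule ex_has_greatest_nat[where P = ?P and f = ?deg])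
  then obtain w where w: "?P w" "\<And>u. ?P u \<Longrightarrow> ?deg u \<le> ?deg w"
    by auto
  have "w \<notin> strict_corners V adj"
  proof
    assume "w \<in> strict_corners V adj"
    then obtain u where u: "strictly_corners V adj u w"
      by (auto simp: strict_corners_def)
    then have "{y \<in> V. adj y w} \<subset> {y \<in> V. adj y u}"
      unfolding strictly_corners_def corners_def by blast
    then have "?deg w < ?deg u"
      using finite_verts by (intro psubset_card_mono) auto
    with w(2)[OF strictly_corners_trans[OF u w(1)]] show False
      by simp
  qed
  moreover have "w \<in> V"
    using w(1) by (simp add: strictly_corners_def corners_def)
  ultimately show ?thesis
    using that w(1) by blast
qed

lemma retract_corner:
  assumes "x \<in> strict_corners V adj"
  shows "retract V adj x \<in> V - strict_corners V adj \<and> strictly_corners V adj (retract V adj x) x"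
proof -
  have "\<exists>w. w \<in> V - strict_corners V adj \<and> strictly_corners V adj w x"
    using strict_corner_dominated[OF assms] by blast
  from someI_ex[OF this] show ?thesis
    using assms by (simp add: retract_def)
qed

lemma retract_in: "x \<in> V \<Longrightarrow> retract V adj x \<in> V - strict_corners V adj"
  using retract_corner[of x] by (auto simp: retract_def)

lemma retract_id: "x \<notin> strict_corners V adj \<Longrightarrow> retract V adj x = x"
  by (simp add: retract_def)

text \<open>The image of \<open>x\<close> keeps all neighbors of \<open>x\<close>. Folding only one
  endpoint is what gains the cop one stage per move.\<close>

lemma adj_retract:
  assumes "x \<in> V" "y \<in> V" "adj x y"
  shows "adj (retract V adj x) y"
proof (cases "x \<in> strict_corners V adj")
  case True
  then have "corners V adj (retract V adj x) x" and *: "retract V adj x \<in> V"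
    using retract_corner[of x] by (auto simp: strictly_corners_def)
  then have "adj y (retract V adj x)"
    using assms adj_sym by (auto simp: corners_def)
  then show ?thesis
    using * assms adj_sym by blast
qed (use assms in \<open>simp add: retract_id\<close>)

lemma retract_hom:
  assumes "x \<in> V" "y \<in> V" "adj x y"
  shows "adj (retract V adj x) (retract V adj y)"
  using assms adj_retract retract_in adj_sym by (meson DiffD1)

lemma core_nonempty: "V - strict_corners V adj \<noteq> {}"
  using retract_in nonempty_verts by blast

lemma reflexive_graph_subset: "U \<subseteq> V \<Longrightarrow> U \<noteq> {} \<Longrightarrow> reflexive_graph U adj"
  by unfold_locales (auto intro: finite_subset[OF _ finite_verts] adj_refl dest: adj_sym[rotated 2])

lemma dominating_not_strict_corner:
  assumes "\<forall>y\<in>V. adj x y" "x \<in> V"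
  shows "x \<notin> strict_corners V adj"
  using assms adj_sym unfolding strict_corners_def strictly_corners_def corners_def by blast

text \<open>A vertex that is not dominating is strictly cornered by the dominating \<open>x\<close>,
  so only dominating vertices survive.\<close>

lemma dominating_imp_core_clique:
  assumes "\<forall>y\<in>V. adj x y" "x \<in> V"
  shows "is_clique (V - strict_corners V adj) adj"
proof -
  have "adj v y" if v: "v \<in> V" "v \<notin> strict_corners V adj" and y: "y \<in> V" for v y
  proof (rule ccontr)
    assume "\<not> adj v y"
    then have "\<not> adj y v"
      using v y adj_sym by blast
    then have "strictly_corners V adj x v"
      using assms v y adj_sym unfolding strictly_corners_def corners_def by blast
    then show False
      using v assms(2) by (auto simp: strict_corners_def)
  qed
  then show ?thesis
    by (auto simp: is_clique_def)
qed

end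


section \<open>Stages and projections\<close>

text \<open>The index counts rounds of folding, so \<open>proj V adj j\<close> lands in
  \<open>stage V adj (Suc j)\<close>.\<close>

primrec proj :: "'a set \<Rightarrow> ('a \<Rightarrow> 'a \<Rightarrow> bool) \<Rightarrow> nat \<Rightarrow> 'a \<Rightarrow> 'a" where
  "proj V adj 0 x = x"
| "proj V adj (Suc j) x = retract (stage V adj (Suc j)) adj (proj V adj j x)"

text \<open>A clique has no strict corners, so this one condition covers both ways in which the
  ranking stops.\<close>

definition last_index :: "'a set \<Rightarrow> ('a \<Rightarrow> 'a \<Rightarrow> bool) \<Rightarrow> nat" where
  "last_index V adj = (LEAST j. strict_corners (stage V adj (Suc j)) adj = {})"

lemma stage_1: "stage V adj (Suc 0) = V"
  by (simp add: stage_def)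

lemma stage_Suc:
  "stage V adj (Suc (Suc j)) =
     stage V adj (Suc j) - strict_corners (stage V adj (Suc j)) adj"
  by (simp add: stage_def)

lemma stage_mono: "stage V adj (Suc (Suc j)) \<subseteq> stage V adj (Suc j)"
  by (auto simp: stage_Suc)

context reflexive_graph
begin

lemma stage_graph: "reflexive_graph (stage V adj (Suc j)) adj \<and> stage V adj (Suc j) \<subseteq> V"
proof (induction j)
  case 0
  then show ?case
    using reflexive_graph_axioms by (simp add: stage_1)
next
  case (Suc j)
  then interpret S: reflexive_graph "stage V adj (Suc j)" adj
    by simp
  show ?case
    using Suc S.core_nonempty S.reflexive_graph_subset[of "stage V adj (Suc (Suc j))"]
    by (auto simp: stage_Suc)
qed

lemma stage_subset: "stage V adj (Suc j) \<subseteq> V"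
  using stage_graph by blast

lemma proj_in: "x \<in> V \<Longrightarrow> proj V adj j x \<in> stage V adj (Suc j)"
proof (induction j)
  case (Suc j)
  interpret S: reflexive_graph "stage V adj (Suc j)" adj
    using stage_graph by blast
  show ?case
    using Suc S.retract_in by (simp add: stage_Suc)
qed (simp add: stage_1)

lemma proj_in_verts: "x \<in> V \<Longrightarrow> proj V adj j x \<in> V"
  using proj_in stage_subset by blast

lemma proj_hom: "x \<in> V \<Longrightarrow> y \<in> V \<Longrightarrow> adj x y \<Longrightarrow> adj (proj V adj j x) (proj V adj j y)"
proof (induction j)
  case (Suc j)
  interpret S: reflexive_graph "stage V adj (Suc j)" adj
    using stage_graph by blast
  show ?case
    using Suc S.retract_hom proj_in by simp
qed simp

text \<open>Only the first endpoint takes the last fold. With \<open>x\<close> the robber's old and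
  \<open>y\<close> his new position, this is the cop's move to the next larger stage.\<close>

lemma proj_hom_Suc:
  assumes "x \<in> V" "y \<in> V" "adj x y"
  shows "adj (proj V adj (Suc j) x) (proj V adj j y)"
proof -
  interpret S: reflexive_graph "stage V adj (Suc j)" adj
    using stage_graph by blast
  show ?thesis
    using assms S.adj_retract proj_in proj_hom by simp
qed

lemma proj_id: "x \<in> stage V adj (Suc j) \<Longrightarrow> proj V adj j x = x"
proof (induction j)
  case (Suc j)
  then have "x \<in> stage V adj (Suc j)" "x \<notin> strict_corners (stage V adj (Suc j)) adj"
    by (auto simp: stage_Suc)
  then show ?case
    using Suc.IH by (simp add: retract_def)
qed simp

lemma ex_no_strict_corners: "\<exists>j. strict_corners (stage V adj (Suc j)) adj = {}"
proof (rule ccontr)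
  assume *: "\<nexists>j. strict_corners (stage V adj (Suc j)) adj = {}"
  have "card (stage V adj (Suc j)) + j \<le> card V" for j
  proof (induction j)
    case 0
    then show ?case
      by (simp add: stage_1)
  next
    case (Suc j)
    have "stage V adj (Suc (Suc j)) \<subset> stage V adj (Suc j)"
      using * by (auto simp: stage_Suc strict_corners_def)
    then have "card (stage V adj (Suc (Suc j))) < card (stage V adj (Suc j))"
      using finite_subset[OF stage_subset finite_verts] by (intro psubset_card_mono)
    then show ?case
      using Suc by simp
  qed
  from this[of "Suc (card V)"] show False
    by simp
qed

lemma last_stage_no_strict_corners:
  "strict_corners (stage V adj (Suc (last_index V adj))) adj = {}"
  unfolding last_index_def using ex_no_strict_corners by (rule LeastI_ex)

lemma strict_corners_before_last:
  "j < last_index V adj \<Longrightarrow> strict_corners (stage V adj (Suc j)) adj \<noteq> {}"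
  unfolding last_index_def using not_less_Least by blast

lemma not_clique_before_last:
  "j < last_index V adj \<Longrightarrow> \<not> is_clique (stage V adj (Suc j)) adj"
  using strict_corners_before_last strict_corners_clique by blast

text \<open>A dominating vertex would make the next stage a clique and end the ranking there. The
  stage just before the last is excluded: domination there is the 1-cop-win case.\<close>

lemma no_dominating_before_last:
  assumes "Suc j < last_index V adj" "x \<in> stage V adj (Suc j)"
  shows "\<exists>y\<in>stage V adj (Suc j). \<not> adj x y"
proof (rule ccontr)
  interpret S: reflexive_graph "stage V adj (Suc j)" adj
    using stage_graph by blast
  assume "\<not> ?thesis"
  then have "is_clique (stage V adj (Suc (Suc j))) adj"
    using S.dominating_imp_core_clique[of x] assms by (simp add: stage_Suc)
  then show False
    using not_clique_before_last assms by blast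
qed

lemma no_dominating_last:
  assumes "\<not> is_clique (stage V adj (Suc (last_index V adj))) adj"
    "x \<in> stage V adj (Suc (last_index V adj))"
  shows "\<exists>y\<in>stage V adj (Suc (last_index V adj)). \<not> adj x y"
proof (rule ccontr)
  interpret S: reflexive_graph "stage V adj (Suc (last_index V adj))" adj
    using stage_graph by blast
  assume "\<not> ?thesis"
  then show False
    using S.dominating_imp_core_clique[of x] assms by (simp add: last_stage_no_strict_corners)
qed


section \<open>The corner rank\<close>

text \<open>The recursion climbs towards \<open>last_index\<close>, so the induction descends from
  it.\<close>

lemma rank_from_stage:
  assumes "j \<le> last_index V adj" "x \<in> stage V adj (Suc j)"
  shows "if x \<in> stage V adj (Suc (last_index V adj))
    then rank_from V adj (Suc j) x =
      (if is_clique (stage V adj (Suc (last_index V adj))) adj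
       then enat (Suc (last_index V adj)) else \<infinity>)
    else \<exists>i\<le>last_index V adj. rank_from V adj (Suc j) x = enat i"
  using assms
proof (induction rule: inc_induct)
  case base
  then show ?case
    by (simp add: rank_from.simps last_stage_no_strict_corners)
next
  case (step j)
  note unfold = rank_from.simps[of V adj "Suc j" x]
  show ?case
  proof (cases "x \<in> strict_corners (stage V adj (Suc j)) adj")
    case True
    have "stage V adj (Suc (last_index V adj)) \<subseteq> stage V adj (Suc (Suc j))"
      using lift_Suc_antimono_le[of "\<lambda>j. stage V adj (Suc j)", OF stage_mono, of "Suc j"] step(2)
      by simp
    then have "x \<notin> stage V adj (Suc (last_index V adj))"
      using True by (auto simp: stage_Suc)
    moreover have "rank_from V adj (Suc j) x = enat (Suc j)"
      using True not_clique_before_last[OF step(2)] strict_corners_before_last[OF step(2)]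
      by (simp add: unfold)
    ultimately show ?thesis
      using step(2) Suc_leI by auto
  next
    case False
    then have "x \<in> stage V adj (Suc (Suc j))"
      using step.prems by (simp add: stage_Suc)
    moreover have "rank_from V adj (Suc j) x = rank_from V adj (Suc (Suc j)) x"
      using False not_clique_before_last[OF step(2)] strict_corners_before_last[OF step(2)]
      by (simp add: unfold)
    ultimately show ?thesis
      using step.IH by simp
  qed
qed

lemma vertex_rank_last:
  assumes "x \<in> stage V adj (Suc (last_index V adj))"
  shows "vertex_rank V adj x =
    (if is_clique (stage V adj (Suc (last_index V adj))) adj
     then enat (Suc (last_index V adj)) else \<infinity>)"
  using rank_from_stage[of 0 x] assms subsetD[OF stage_subset] by (simp add: vertex_rank_def stage_1)

lemma vertex_rank_before_last:
  assumes "x \<in> V" "x \<notin> stage V adj (Suc (last_index V adj))"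
  shows "\<exists>i\<le>last_index V adj. vertex_rank V adj x = enat i"
  using rank_from_stage[of 0 x] assms by (simp add: vertex_rank_def stage_1)

lemma corner_rank_eq:
  "corner_rank V adj =
    (if is_clique (stage V adj (Suc (last_index V adj))) adj
     then enat (Suc (last_index V adj)) else \<infinity>)" (is "_ = ?R")
  unfolding corner_rank_def
proof (rule Max_eqI)
  show "finite (vertex_rank V adj ` V)"
    using finite_verts by simp
next
  fix y
  assume "y \<in> vertex_rank V adj ` V"
  then obtain x where "x \<in> V" "y = vertex_rank V adj x"
    by blast
  then show "y \<le> ?R"
    using vertex_rank_last[of x] vertex_rank_before_last[of x]
    by (cases "x \<in> stage V adj (Suc (last_index V adj))") auto
next
  obtain x where "x \<in> stage V adj (Suc (last_index V adj))"
    using stage_graph reflexive_graph.nonempty_verts by fastforce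
  then show "?R \<in> vertex_rank V adj ` V"
    using vertex_rank_last[of x] stage_subset by force
qed

text \<open>The vertices of maximal rank are exactly those of the last stage, and
  \<open>last_index V adj > 0\<close> encodes \<alpha> \<ge> 2.\<close>

lemma one_cop_win_iff:
  assumes "is_clique (stage V adj (Suc (last_index V adj))) adj"
  shows "one_cop_win V adj \<longleftrightarrow> last_index V adj > 0 \<and>
    (\<exists>x\<in>stage V adj (Suc (last_index V adj)). \<forall>y\<in>stage V adj (last_index V adj). adj x y)"
proof -
  have "x \<in> V \<and> vertex_rank V adj x = enat (Suc (last_index V adj)) \<longleftrightarrow>
      x \<in> stage V adj (Suc (last_index V adj))" for x
    using vertex_rank_last[of x] vertex_rank_before_last[of x] assms stage_subset
    by (cases "x \<in> stage V adj (Suc (last_index V adj))") auto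
  then show ?thesis
    unfolding one_cop_win_def corner_rank_eq using assms by auto
qed


section \<open>Strategies\<close>

text \<open>The cop's \<open>n\<close>-th move goes to the robber's image under
  \<open>proj V adj (K - n)\<close>. After the first move, \<open>proj_hom_Suc\<close> keeps this
  legal, and the \<open>K\<close>-th move captures since \<open>proj V adj 0\<close> is the
  identity.\<close>

lemma cop_wins_withinI:
  assumes "c \<in> V" "K > 0" "\<And>r. r \<in> V \<Longrightarrow> adj c (proj V adj (K - 1) r)"
  shows "cop_wins_within V adj K"
proof -
  \<comment> \<open>\<open>length xs\<close> numbers the cop's move. From move \<open>K\<close> on,
    the truncated difference is 0 and the cop steps onto the robber's last known position.\<close>
  define \<sigma> where "\<sigma> xs = (if xs = [] then c else proj V adj (K - length xs) (last xs))" for xs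
  have pos_0: "cop_pos \<sigma> \<rho> 0 = c" for \<rho>
    by (simp add: cop_pos_def \<sigma>_def)
  have pos_Suc: "cop_pos \<sigma> \<rho> (Suc n) = proj V adj (K - Suc n) (\<rho> n)" for \<rho> n
    by (simp add: cop_pos_def \<sigma>_def)
  have "cop_strategy V adj \<sigma>"
    unfolding cop_strategy_def
  proof (intro allI impI)
    fix \<rho> n
    assume \<rho>: "robber_play V adj \<rho>"
    then have \<rho>_in: "\<rho> m \<in> V" and \<rho>_adj: "adj (\<rho> m) (\<rho> (Suc m))" for m
      by (auto simp: robber_play_def)
    show "cop_pos \<sigma> \<rho> n \<in> V \<and> adj (cop_pos \<sigma> \<rho> n) (cop_pos \<sigma> \<rho> (Suc n))"
    proof (cases n)
      case 0
      then show ?thesis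
        using assms \<rho>_in by (simp add: pos_0 pos_Suc)
    next
      case (Suc m)
      show ?thesis
      proof (cases "Suc m < K")
        case True
        then have "K - Suc m = Suc (K - Suc (Suc m))"
          by simp
        then have "adj (proj V adj (K - Suc m) (\<rho> m)) (proj V adj (K - Suc (Suc m)) (\<rho> (Suc m)))"
          using proj_hom_Suc[OF \<rho>_in \<rho>_in \<rho>_adj] by metis
        then show ?thesis
          by (simp only: Suc pos_Suc proj_in_verts[OF \<rho>_in] simp_thms)
      qed (use Suc \<rho>_in \<rho>_adj in \<open>simp add: pos_Suc\<close>)
    qed
  qed
  moreover have "captured_within \<sigma> \<rho> K" for \<rho>
  proof -
    have "cop_pos \<sigma> \<rho> (Suc (K - 1)) = \<rho> (K - 1)"
      using assms(2) by (simp only: pos_Suc) simp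
    then show ?thesis
      unfolding captured_within_def using assms(2) by (metis diff_less zero_less_one)
  qed
  ultimately show ?thesis
    unfolding cop_wins_within_def by blast
qed

section \<open>Robber strategies and lower bounds\<close>

text \<open>\<open>S t c r\<close> is an invariant for the positions just before the cop's move
  \<open>t + 1\<close>. As \<open>\<sigma>\<close> fixes the cop's replies, dependent choice
  assembles the robber's local answers into one infinite play.\<close>

lemma ex_robber_play:
  fixes S :: "nat \<Rightarrow> 'a \<Rightarrow> 'a \<Rightarrow> bool"
  assumes \<sigma>: "cop_strategy V adj \<sigma>"
    and start: "\<And>c. c \<in> V \<Longrightarrow> \<exists>r\<in>V. S 0 c r"
    and step: "\<And>t c r c'. c \<in> V \<Longrightarrow> r \<in> V \<Longrightarrow> c' \<in> V \<Longrightarrow> adj c c' \<Longrightarrow> S t c r \<Longrightarrow>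
      \<exists>r'\<in>V. adj r r' \<and> S (Suc t) c' r'"
  shows "\<exists>\<rho>. robber_play V adj \<rho> \<and> (\<forall>t. S t (cop_pos \<sigma> \<rho> t) (\<rho> t))"
proof -
  define legal where "legal t xs \<longleftrightarrow>
    length xs = Suc t \<and> set xs \<subseteq> V \<and> (\<forall>i<t. adj (xs ! i) (xs ! Suc i))" for t xs
  \<comment> \<open>The cop's moves are known to be legal against infinite plays only, so a finite history is
    continued by staying put.\<close>
  have cop_legal: "\<sigma> (butlast xs) \<in> V \<and> \<sigma> xs \<in> V \<and> adj (\<sigma> (butlast xs)) (\<sigma> xs)"
    if "legal t xs" for t xs
  proof -
    let ?\<rho> = "\<lambda>i. xs ! min i t"
    have "robber_play V adj ?\<rho>"
      unfolding robber_play_def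
    proof (intro allI conjI)
      fix n
      show in_V: "xs ! min n t \<in> V"
        using that nth_mem[of "min n t" xs] by (auto simp: legal_def)
      show "adj (xs ! min n t) (xs ! min (Suc n) t)"
        using that adj_refl[OF in_V] by (cases "n < t") (auto simp: legal_def)
    qed
    moreover have "map ?\<rho> [0..<t] = butlast xs"
      using that by (intro nth_equalityI) (auto simp: legal_def nth_butlast)
    moreover have "map ?\<rho> [0..<Suc t] = xs"
      using that by (intro nth_equalityI) (auto simp: legal_def min_def simp del: upt_Suc)
    ultimately show ?thesis
      using \<sigma> unfolding cop_strategy_def cop_pos_def by metis
  qed
  \<comment> \<open>\<open>h t\<close> lists the robber's positions up to time \<open>t\<close>. The
    cop has seen all but the last and stands at \<open>\<sigma> (butlast (h t))\<close>.\<close>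
  have "\<exists>h. \<forall>t. (legal t (h t) \<and> S t (\<sigma> (butlast (h t))) (last (h t))) \<and> butlast (h (Suc t)) = h t"
  proof (rule dependent_nat_choice)
    obtain v where "v \<in> V"
      using nonempty_verts by blast
    then have "\<sigma> [] \<in> V"
      using cop_legal[of 0 "[v]"] by (simp add: legal_def)
    then obtain r where "r \<in> V" "S 0 (\<sigma> []) r"
      using start by blast
    then show "\<exists>xs. legal 0 xs \<and> S 0 (\<sigma> (butlast xs)) (last xs)"
      by (intro exI[of _ "[r]"]) (simp add: legal_def)
  next
    fix xs t
    assume xs: "legal t xs \<and> S t (\<sigma> (butlast xs)) (last xs)"
    then have "xs \<noteq> []"
      by (auto simp: legal_def)
    then have "last xs \<in> V" and last: "last xs = xs ! t"
      using xs last_in_set[of xs] by (auto simp: legal_def last_conv_nth)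
    then obtain r where r: "r \<in> V" "adj (last xs) r" "S (Suc t) (\<sigma> xs) r"
      using step cop_legal xs by meson
    then have "legal (Suc t) (xs @ [r])"
      using xs last by (auto simp: legal_def nth_append less_Suc_eq)
    then show "\<exists>ys. (legal (Suc t) ys \<and> S (Suc t) (\<sigma> (butlast ys)) (last ys)) \<and> butlast ys = xs"
      using r by (intro exI[of _ "xs @ [r]"]) simp
  qed
  then obtain h where h: "\<And>t. legal t (h t)" "\<And>t. S t (\<sigma> (butlast (h t))) (last (h t))"
    "\<And>t. butlast (h (Suc t)) = h t"
    by blast
  define \<rho> where "\<rho> t = last (h t)" for t
  have h_snoc: "h t = butlast (h t) @ [\<rho> t]" for t
    using h(1)[of t] by (auto simp: \<rho>_def legal_def intro: append_butlast_last_id[symmetric])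
  have h_eq: "h t = map \<rho> [0..<Suc t]" for t
  proof (induction t)
    case 0
    have "butlast (h 0) = []"
      using h(1)[of 0] by (cases "h 0") (auto simp: legal_def)
    then show ?case
      using h_snoc[of 0] by simp
  next
    case (Suc t)
    then show ?case
      using h_snoc[of "Suc t"] h(3)[of t] by simp
  qed
  have "robber_play V adj \<rho>"
    unfolding robber_play_def
  proof (intro allI conjI)
    fix n
    show "\<rho> n \<in> V"
      using h(1)[of n] by (auto simp: legal_def h_eq)
    show "adj (\<rho> n) (\<rho> (Suc n))"
      using h(1)[of "Suc n"] by (auto simp: legal_def h_eq nth_append)
  qed
  moreover have "butlast (h t) = map \<rho> [0..<t]" for t
    by (simp add: h_eq)
  then have "S t (cop_pos \<sigma> \<rho> t) (\<rho> t)" for t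
    using h(2)[of t] by (simp add: cop_pos_def \<rho>_def)
  ultimately show ?thesis
    by blast
qed

text \<open>With the cop to move, this suffices for the robber at \<open>r\<close> to survive \<open>n\<close> moves of the cop at \<open>c\<close>.\<close>

definition safe :: "nat \<Rightarrow> 'a \<Rightarrow> 'a \<Rightarrow> bool" where
  "safe n c r \<longleftrightarrow> (case n of 0 \<Rightarrow> c \<noteq> r
     | Suc j \<Rightarrow> r \<in> stage V adj (Suc j) \<and> \<not> adj (proj V adj j c) r)"

lemma safe_neq: "safe n c r \<Longrightarrow> r \<in> V \<Longrightarrow> c \<noteq> r"
  using proj_id adj_refl by (fastforce simp: safe_def split: nat.splits)

text \<open>Projection fixes \<open>r\<close> and preserves edges, so a capturing move would make
  \<open>r\<close> adjacent to the projection of \<open>c\<close>.\<close>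

lemma safe_move_neq:
  assumes "safe (Suc n) c r" "c \<in> V" "c' \<in> V" "adj c c'"
  shows "c' \<noteq> r"
  using assms proj_hom[of c c' n] proj_id[of r n] by (auto simp: safe_def)

text \<open>Without an escape in the larger stage, the projection of \<open>c'\<close> there would
  be a twin of \<open>r\<close> and survive the next fold; then the projection of \<open>c\<close>
  to the smaller stage would already be adjacent to \<open>r\<close>. For \<open>n = 0\<close> the
  robber stays put.\<close>

lemma safe_step:
  assumes "safe (Suc n) c r" "c \<in> V" "c' \<in> V" "adj c c'"
  shows "\<exists>r'\<in>V. adj r r' \<and> safe n c' r'"
proof (cases n)
  case 0
  then have "r \<in> V"
    using assms(1) by (simp add: safe_def stage_1)
  then show ?thesis
    using 0 safe_move_neq[OF assms] adj_refl by (auto simp: safe_def)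
next
  case (Suc j)
  let ?U = "stage V adj (Suc j)" and ?p = "proj V adj j c'"
  interpret S: reflexive_graph ?U adj
    using stage_graph by blast
  have r: "r \<in> ?U" "r \<notin> strict_corners ?U adj" and nadj: "\<not> adj (proj V adj (Suc j) c) r"
    using assms(1) Suc by (auto simp: safe_def stage_Suc)
  have p: "?p \<in> ?U"
    using assms proj_in by blast
  have "\<exists>r'\<in>?U. adj r r' \<and> \<not> adj ?p r'"
  proof (rule ccontr)
    assume "\<not> ?thesis"
    then have sub: "adj x ?p" if "x \<in> ?U" "adj x r" for x
      using that r p S.adj_sym by blast
    \<comment> \<open>Since \<open>r\<close> is not a strict corner, the cop's projection is a twin of \<open>r\<close>.\<close>
    have twin: "adj x r" if "x \<in> ?U" "adj x ?p" for x
    proof (rule ccontr)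
      assume "\<not> adj x r"
      then have "strictly_corners ?U adj ?p r"
        using that r p sub by (auto simp: strictly_corners_def corners_def)
      then show False
        using r p by (auto simp: strict_corners_def)
    qed
    have "?p \<notin> strict_corners ?U adj"
    proof
      assume "?p \<in> strict_corners ?U adj"
      then obtain u where u: "u \<in> ?U" "strictly_corners ?U adj u ?p"
        by (auto simp: strict_corners_def)
      have "strictly_corners ?U adj u r"
        using u r p sub twin S.adj_refl unfolding strictly_corners_def corners_def by metis
      then show False
        using u r by (auto simp: strict_corners_def)
    qed
    then have "proj V adj (Suc j) c' = ?p"
      by (simp add: retract_def)
    then have "adj (proj V adj (Suc j) c) ?p"
      using proj_hom[of c c' "Suc j"] assms by simp
    then have "adj (proj V adj (Suc j) c) r"
      using twin[OF subsetD[OF stage_mono proj_in[OF assms(2)]]] by simp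
    then show False
      using nadj by simp
  qed
  then show ?thesis
    using Suc stage_subset by (fastforce simp: safe_def)
qed

lemma safe_start_imp_not_cop_wins_within:
  assumes "\<And>c. c \<in> V \<Longrightarrow> \<exists>r\<in>V. safe n c r"
  shows "\<not> cop_wins_within V adj n"
proof
  assume "cop_wins_within V adj n"
  then obtain \<sigma> where \<sigma>: "cop_strategy V adj \<sigma>"
    and win: "\<And>\<rho>. robber_play V adj \<rho> \<Longrightarrow> captured_within \<sigma> \<rho> n"
    unfolding cop_wins_within_def by blast
  \<comment> \<open>The safety level drops by one per round; after time \<open>n\<close> nothing is
    demanded.\<close>
  have "\<exists>\<rho>. robber_play V adj \<rho> \<and> (\<forall>t. t \<le> n \<longrightarrow> safe (n - t) (cop_pos \<sigma> \<rho> t) (\<rho> t))"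
  proof (rule ex_robber_play[OF \<sigma>])
    show "\<exists>r\<in>V. 0 \<le> n \<longrightarrow> safe (n - 0) c r" if "c \<in> V" for c
      using assms that by simp
  next
    fix t c r c'
    assume *: "c \<in> V" "r \<in> V" "c' \<in> V" "adj c c'" "t \<le> n \<longrightarrow> safe (n - t) c r"
    show "\<exists>r'\<in>V. adj r r' \<and> (Suc t \<le> n \<longrightarrow> safe (n - Suc t) c' r')"
    proof (cases "Suc t \<le> n")
      case True
      then have "safe (Suc (n - Suc t)) c r"
        using * by (simp add: Suc_diff_Suc)
      then show ?thesis
        using safe_step * by blast
    qed (use * adj_refl in auto)
  qed
  then obtain \<rho> where \<rho>: "robber_play V adj \<rho>"
    and s: "\<And>t. t \<le> n \<Longrightarrow> safe (n - t) (cop_pos \<sigma> \<rho> t) (\<rho> t)"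
    by blast
  have "cop_pos \<sigma> \<rho> m \<noteq> \<rho> m" if "m \<le> n" for m
    using safe_neq[OF s[OF that]] \<rho> by (simp add: robber_play_def)
  moreover have "cop_pos \<sigma> \<rho> (Suc m) \<noteq> \<rho> m" if "m < n" for m
  proof -
    have "safe (Suc (n - Suc m)) (cop_pos \<sigma> \<rho> m) (\<rho> m)"
      using s[of m] that by (simp add: Suc_diff_Suc)
    then show ?thesis
      using safe_move_neq \<sigma> \<rho> unfolding cop_strategy_def by blast
  qed
  ultimately show False
    using win[OF \<rho>] by (auto simp: captured_within_def)
qed

lemma not_clique_imp_not_cop_win:
  assumes "\<not> is_clique (stage V adj (Suc (last_index V adj))) adj"
  shows "\<not> cop_win V adj"
proof
  let ?n = "Suc (last_index V adj)"
  assume "cop_win V adj"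
  then obtain \<sigma> where \<sigma>: "cop_strategy V adj \<sigma>"
    and win: "\<And>\<rho>. robber_play V adj \<rho> \<Longrightarrow> \<exists>n. captured_within \<sigma> \<rho> n"
    unfolding cop_win_def by blast
  \<comment> \<open>Nothing is removed from the last stage and its fold is the identity, so the
    level lost in each round is regained and the robber survives forever.\<close>
  have safe_Suc: "safe (Suc ?n) c r" if "safe ?n c r" for c r
    using that last_stage_no_strict_corners by (simp add: safe_def stage_Suc retract_def)
  have "\<exists>\<rho>. robber_play V adj \<rho> \<and> (\<forall>t::nat. safe ?n (cop_pos \<sigma> \<rho> t) (\<rho> t))"
  proof (rule ex_robber_play[OF \<sigma>])
    show "\<exists>r\<in>V. safe ?n c r" if "c \<in> V" for c
      using no_dominating_last[OF assms proj_in[OF that]] stage_subset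
      by (fastforce simp: safe_def)
  qed (use safe_step safe_Suc in blast)
  then obtain \<rho> where \<rho>: "robber_play V adj \<rho>"
    and s: "\<And>t. safe ?n (cop_pos \<sigma> \<rho> t) (\<rho> t)"
    by blast
  have "cop_pos \<sigma> \<rho> m \<noteq> \<rho> m" for m
    using safe_neq[OF s] \<rho> by (simp add: robber_play_def)
  moreover have "cop_pos \<sigma> \<rho> (Suc m) \<noteq> \<rho> m" for m
    using safe_move_neq s \<sigma> \<rho> unfolding cop_strategy_def by blast
  ultimately show False
    using win[OF \<rho>] by (auto simp: captured_within_def)
qed

end

section \<open>Capture time\<close>

lemma cop_wins_within_mono:
  assumes "cop_wins_within V adj m" "m \<le> n"
  shows "cop_wins_within V adj n"
proof -
  have "captured_within \<sigma> \<rho> n" if "captured_within \<sigma> \<rho> m" for \<sigma> \<rho>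
    using that assms(2) unfolding captured_within_def by (meson le_trans less_le_trans)
  then show ?thesis
    using assms(1) unfolding cop_wins_within_def by blast
qed

lemma capture_time_eq:
  assumes "cop_wins_within V adj (Suc n)" "\<not> cop_wins_within V adj n"
  shows "capture_time V adj = Suc n"
  unfolding capture_time_def
proof (rule Least_equality)
  show "Suc n \<le> m" if "cop_wins_within V adj m" for m
    using that assms(2) cop_wins_within_mono not_less_eq_eq by blast
qed (rule assms(1))

context reflexive_graph
begin

lemma cop_wins_within_last:
  assumes "is_clique (stage V adj (Suc (last_index V adj))) adj"
  shows "cop_wins_within V adj (Suc (last_index V adj))"
proof -
  obtain c where "c \<in> stage V adj (Suc (last_index V adj))"
    using stage_graph reflexive_graph.nonempty_verts by fastforce
  then show ?thesis
    using assms proj_in subsetD[OF stage_subset] by (intro cop_wins_withinI[of c]) (auto simp: is_clique_def)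
qed

lemma cop_win_iff: "cop_win V adj \<longleftrightarrow> is_clique (stage V adj (Suc (last_index V adj))) adj"
  using cop_wins_within_last not_clique_imp_not_cop_win
  unfolding cop_win_def cop_wins_within_def by blast

text \<open>A vertex dominating \<open>stage V adj (Suc j)\<close> would be no strict corner, hence
  lie in the last stage and witness \<open>one_cop_win\<close>. So against any cop start the robber
  has a start of safety level \<open>Suc j\<close>.\<close>

lemma capture_time_zero_cop_win:
  assumes "is_clique (stage V adj (Suc (Suc j))) adj" "last_index V adj = Suc j"
    "\<not> one_cop_win V adj"
  shows "capture_time V adj = Suc (Suc j)"
proof (rule capture_time_eq)
  show "cop_wins_within V adj (Suc (Suc j))"
    using cop_wins_within_last assms by simp
  interpret S: reflexive_graph "stage V adj (Suc j)" adj
    using stage_graph by blast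
  have "\<exists>y\<in>stage V adj (Suc j). \<not> adj x y" if x: "x \<in> stage V adj (Suc j)" for x
  proof (rule ccontr)
    assume *: "\<not> ?thesis"
    then have "x \<in> stage V adj (Suc (Suc j))"
      using x S.dominating_not_strict_corner by (auto simp: stage_Suc)
    then show False
      using * assms one_cop_win_iff by auto
  qed
  then show "\<not> cop_wins_within V adj (Suc j)"
    using proj_in stage_subset
    by (intro safe_start_imp_not_cop_wins_within) (fastforce simp: safe_def)
qed

text \<open>Starting at the dominating vertex, adjacent to all projections to
  \<open>stage V adj (Suc j)\<close>, saves the cop one move. For \<open>j > 0\<close> the stage
  before has no dominating vertex, which gives the lower bound.\<close>

lemma capture_time_one_cop_win:
  assumes "is_clique (stage V adj (Suc (Suc j))) adj" "last_index V adj = Suc j"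
    "one_cop_win V adj"
  shows "capture_time V adj = Suc j"
proof (rule capture_time_eq)
  obtain c where "c \<in> stage V adj (Suc (Suc j))" "\<forall>y\<in>stage V adj (Suc j). adj c y"
    using assms one_cop_win_iff by auto
  then show "cop_wins_within V adj (Suc j)"
    using proj_in subsetD[OF stage_subset] by (intro cop_wins_withinI[of c]) auto
  have "\<exists>r\<in>V. safe j c r" if c: "c \<in> V" for c
  proof (cases j)
    case 0
    \<comment> \<open>Level 0 asks only for a vertex other than \<open>c\<close>; a single reflexive
      vertex would be a clique.\<close>
    then have "\<not> is_clique V adj"
      using not_clique_before_last[of 0] assms by (simp add: stage_1)
    then have "V \<noteq> {c}"
      using adj_refl by (auto simp: is_clique_def)
    then show ?thesis
      using 0 c by (auto simp: safe_def)
  next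
    case (Suc i)
    then show ?thesis
      using no_dominating_before_last[of i, OF _ proj_in[OF c]] assms stage_subset
      by (fastforce simp: safe_def)
  qed
  then show "\<not> cop_wins_within V adj j"
    by (rule safe_start_imp_not_cop_wins_within)
qed

end

theorem theorem6p1:
  fixes V :: "'a set" and adj :: "'a \<Rightarrow> 'a \<Rightarrow> bool"
  assumes "reflexive_graph V adj"
  shows "(cop_win V adj \<longleftrightarrow> finite_corner_rank V adj) \<and>
    (\<forall>(r::nat) (\<alpha>::nat). r \<in> {0, 1} \<and> corner_rank V adj = enat \<alpha> \<and> \<alpha> \<ge> 2 \<and> r_cop_win r V adj
       \<longrightarrow> capture_time V adj = \<alpha> - r)"
proof -
  interpret reflexive_graph V adj
    by (rule assms)
  have "capture_time V adj = \<alpha> - r"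
    if rank: "corner_rank V adj = enat \<alpha>" "\<alpha> \<ge> 2" and r: "r_cop_win r V adj" for r \<alpha>
  proof -
    have clique: "is_clique (stage V adj (Suc (last_index V adj))) adj"
      and \<alpha>: "\<alpha> = Suc (last_index V adj)"
      using rank(1) by (auto simp: corner_rank_eq split: if_splits)
    then obtain j where "last_index V adj = Suc j"
      using rank(2) by (cases "last_index V adj") auto
    then show ?thesis
      using clique \<alpha> r capture_time_zero_cop_win[of j] capture_time_one_cop_win[of j]
      by (auto simp: r_cop_win_def zero_cop_win_def)
  qed
  moreover have "cop_win V adj \<longleftrightarrow> finite_corner_rank V adj"
    by (simp add: cop_win_iff finite_corner_rank_def corner_rank_eq)
  ultimately show ?thesis
    by blast
qed

end
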